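(* Let $G$ be a finite strongly semi-3-abelian 3-group, let $r\ge 1$ be an integer with $\exp(G)\le 3^{r}$, and suppose $G$ can be generated by $d$ elements. Then the nilpotency class of $G$ satisfies $c(G)\le (r-1)(d+1)+3$.
   Context: Let $p$ be a prime and $G$ a finite $p$-group. For a positive integer $i$, $G$ is called semi-$p^{i}$-abelian if for all $a,b\in G$: $(ab)^{p^{i}}=1$ if and only if $a^{p^{i}}b^{p^{i}}=1$. $G$ is called strongly semi-$p$-abelian if it is semi-$p^{i}$-abelian for every positive integer $i$. $c(G)$ denotes the nilpotency class of $G$. *)

theory Defs
  imports "HOL-Algebra.Algebra"
begin

definition p_group :: "nat \<Rightarrow> ('a, 'b) monoid_scheme \<Rightarrow> bool" where
  "p_group p G \<longleftrightarrow> group G \<and> finite (carrier G) \<and> (\<exists>n. order G = p ^ n)"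

definition semi_pi_abelian :: "nat \<Rightarrow> nat \<Rightarrow> ('a, 'b) monoid_scheme \<Rightarrow> bool" where
  "semi_pi_abelian p i G \<longleftrightarrow>
     (\<forall>a \<in> carrier G. \<forall>b \<in> carrier G.
        (a \<otimes>\<^bsub>G\<^esub> b) [^]\<^bsub>G\<^esub> (p ^ i) = \<one>\<^bsub>G\<^esub> \<longleftrightarrow>
        (a [^]\<^bsub>G\<^esub> (p ^ i)) \<otimes>\<^bsub>G\<^esub> (b [^]\<^bsub>G\<^esub> (p ^ i)) = \<one>\<^bsub>G\<^esub>)"

definition strongly_semi_p_abelian :: "nat \<Rightarrow> ('a, 'b) monoid_scheme \<Rightarrow> bool" where
  "strongly_semi_p_abelian p G \<longleftrightarrow> (\<forall>i::nat. i \<ge> 1 \<longrightarrow> semi_pi_abelian p i G)"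

definition group_exponent :: "('a, 'b) monoid_scheme \<Rightarrow> nat" where
  "group_exponent G = Lcm ((\<lambda>x. group.ord G x) ` carrier G)"

text \<open>Commutator subgroup [H,K] and lower central series;
  lower_central G 0 = G = gamma_1, lower_central G n = gamma_(n+1).\<close>
definition comm_subgroup :: "('a, 'b) monoid_scheme \<Rightarrow> 'a set \<Rightarrow> 'a set \<Rightarrow> 'a set" where
  "comm_subgroup G H K = generate G
     {h \<otimes>\<^bsub>G\<^esub> k \<otimes>\<^bsub>G\<^esub> inv\<^bsub>G\<^esub> h \<otimes>\<^bsub>G\<^esub> inv\<^bsub>G\<^esub> k | h k. h \<in> H \<and> k \<in> K}"

fun lower_central :: "('a, 'b) monoid_scheme \<Rightarrow> nat \<Rightarrow> 'a set" where
  "lower_central G 0 = carrier G"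
| "lower_central G (Suc n) = comm_subgroup G (lower_central G n) (carrier G)"

definition nilpotency_class :: "('a, 'b) monoid_scheme \<Rightarrow> nat" where
  "nilpotency_class G = (LEAST c. lower_central G c = {\<one>\<^bsub>G\<^esub>})"

definition generated_by_at_most :: "nat \<Rightarrow> ('a, 'b) monoid_scheme \<Rightarrow> bool" where
  "generated_by_at_most d G \<longleftrightarrow>
     (\<exists>S. S \<subseteq> carrier G \<and> finite S \<and> card S \<le> d \<and> generate G S = carrier G)"

end

theory Submission
  imports Defs
begin

text \<open>
  Write \<open>N\<^sub>i\<close> for the set of elements killed by \<open>3^i\<close>; it is a normal subgroup, and the quotient
  by it is semi-3-abelian. In a semi-3-abelian group an element \<open>n\<close> with \<open>n^3 = 1\<close> satisfies
  \<open>(g n)^3 = g^3\<close> for all \<open>g\<close>, that is \<open>n n\<^sup>g n\<^sup>g\<^sup>g = 1\<close>. Using also \<open>g\<close> inverse, \<open>n\<close> commutes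
  with all its conjugates, so it lies in an abelian normal subgroup of exponent 3, on which every
  operator \<open>[_, g]\<close> squares to zero. Then these operators anticommute, and since the one for a
  product \<open>g h\<close> does so too, a product of three of them vanishes: \<open>[n, a, b, c] = 1\<close>. Hence
  \<open>[N\<^sub>i\<^sub>+\<^sub>1, G, G, G]\<close> lies in \<open>N\<^sub>i\<close>, which bounds the class by \<open>3 r\<close>. This suffices unless
  \<open>d\<close> is at most 1, where \<open>G\<close> is cyclic.
\<close>

section \<open>Square-zero operators on an abelian group of exponent 3\<close>

text \<open>
  The operators form no ring here, so the computation with \<open>D (f g h) = D g + D h - D g (D h)\<close> is
  carried out on arguments, with the subtracted term moved across to avoid inverses.
\<close>
lemma (in comm_group) square_zero_operators_triple:
  fixes D :: "'g \<Rightarrow> 'a \<Rightarrow> 'a" and f :: "'g \<Rightarrow> 'g \<Rightarrow> 'g"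
  assumes S: "\<And>g h. g \<in> S \<Longrightarrow> h \<in> S \<Longrightarrow> f g h \<in> S"
    and cl: "\<And>g x. g \<in> S \<Longrightarrow> x \<in> carrier G \<Longrightarrow> D g x \<in> carrier G"
    and hom: "\<And>g x y. g \<in> S \<Longrightarrow> x \<in> carrier G \<Longrightarrow> y \<in> carrier G \<Longrightarrow> D g (x \<otimes> y) = D g x \<otimes> D g y"
    and sq: "\<And>g x. g \<in> S \<Longrightarrow> x \<in> carrier G \<Longrightarrow> D g (D g x) = \<one>"
    and comp: "\<And>g h x. g \<in> S \<Longrightarrow> h \<in> S \<Longrightarrow> x \<in> carrier G \<Longrightarrow>
      D (f g h) x \<otimes> D g (D h x) = D g x \<otimes> D h x"
    and cube: "\<And>x. x \<in> carrier G \<Longrightarrow> x \<otimes> x \<otimes> x = \<one>"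
    and a: "a \<in> S" and b: "b \<in> S" and c: "c \<in> S" and x: "x \<in> carrier G"
  shows "D a (D b (D c x)) = \<one>"
proof -
  have one: "D g \<one> = \<one>" if "g \<in> S" for g
    using hom[OF that one_closed one_closed] cl[OF that one_closed] by simp
  have key: "D g (D (f g h) x) \<otimes> D h (D (f g h) x) = \<one> \<and> D g (D h (D g x)) = \<one>"
    if g: "g \<in> S" and h: "h \<in> S" and x: "x \<in> carrier G" for g h x
  proof -
    \<comment> \<open>Write P for \<open>D (f g h)\<close>. Since P squares to zero,
      \<open>comp\<close> at \<open>D (f g h) x\<close> reduces to \<open>sum\<close>. Applying
      \<open>D g\<close> to \<open>sum\<close> and cancelling its squares gives
      \<open>zero\<close>.\<close>
    have sum: "D g (D h (D (f g h) x)) = D g (D (f g h) x) \<otimes> D h (D (f g h) x)"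
      and zero: "D g (D h (D (f g h) x)) = \<one>" if x: "x \<in> carrier G" for x
    proof -
      let ?y = "D (f g h) x"
      have y: "?y \<in> carrier G" using S cl g h x by simp
      show s: "D g (D h ?y) = D g ?y \<otimes> D h ?y"
        using comp[OF g h y] sq[OF S[OF g h] x] y cl g h by simp
      have "D g (D g (D h ?y)) = D g (D g ?y) \<otimes> D g (D h ?y)"
        unfolding s using hom y cl g h s by simp
      then show "D g (D h ?y) = \<one>" using sq y cl g h by simp
    qed
    \<comment> \<open>Apply \<open>D g\<close> after \<open>D h\<close> to both sides of
      \<open>comp\<close>: the P term vanishes by \<open>zero\<close>, and
      \<open>D h (D h x)\<close> is trivial.\<close>
    have quad: "D g (D h (D g (D h x))) = D g (D h (D g x))" if x: "x \<in> carrier G" for x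
    proof -
      have "D g (D h (D (f g h) x \<otimes> D g (D h x))) = D g (D h (D g x \<otimes> D h x))"
        using comp[OF g h x] by simp
      then show ?thesis using zero[OF x] sq one hom cl g h x S by simp
    qed
    \<comment> \<open>With \<open>D h x\<close> in place of \<open>x\<close>, the left side of
      \<open>quad\<close> contains the square of \<open>D h\<close> and its right side is the
      fourfold product wanted here.\<close>
    have "D g (D h (D g (D h x))) = \<one>"
      using quad[OF cl[OF h x]] sq one cl g h x by simp
    then show ?thesis using sum zero quad x by metis
  qed
  have anti: "D g (D h x) \<otimes> D h (D g x) = \<one>"
    if g: "g \<in> S" and h: "h \<in> S" and x: "x \<in> carrier G" for g h x
  proof -
    let ?y = "D (f g h) x"
    have y: "?y \<in> carrier G" using S cl g h x by simp
    \<comment> \<open>Applying \<open>D g\<close> to this equation turns \<open>D g ?y\<close> into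
      \<open>D g (D h x)\<close>. Applying \<open>D h\<close> turns \<open>D h ?y\<close> into
      \<open>D h (D g x)\<close>, where \<open>key\<close> with \<open>g\<close> and
      \<open>h\<close> exchanged removes the threefold product. \<open>key\<close> then says that
      the two results cancel.\<close>
    have c': "?y \<otimes> D g (D h x) = D g x \<otimes> D h x" using comp g h x by simp
    have "D g (?y \<otimes> D g (D h x)) = D g (D h x)"
      unfolding c' using hom sq one cl g h x by simp
    then have 1: "D g ?y = D g (D h x)"
      using hom sq cl g h x y by simp
    have "D h (?y \<otimes> D g (D h x)) = D h (D g x)"
      unfolding c' using hom sq one cl g h x by simp
    then have 2: "D h ?y = D h (D g x)"
      using hom key[OF h g x] cl g h x y by simp
    show ?thesis using key[OF g h x] 1 2 by simp
  qed
  let ?u = "D a (D b (D c x))"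
  have u: "?u \<in> carrier G" using cl a b c x by simp
  have ab: "f a b \<in> S" using S a b by simp
  have 1: "D (f a b) (D c x) \<otimes> ?u = D a (D c x) \<otimes> D b (D c x)"
    using comp cl a b c x by simp
  have 2: "D c (D (f a b) x) \<otimes> D c (D a (D b x)) = D c (D a x) \<otimes> D c (D b x)"
    using arg_cong[OF comp[OF a b x], of "D c"] hom cl a b c x ab by simp
  \<comment> \<open>Add the two expansions. Anticommutation of \<open>c\<close> with
    \<open>f a b\<close>, with \<open>a\<close> and with \<open>b\<close> leaves only the two
    threefold products.\<close>
  have "(D (f a b) (D c x) \<otimes> D c (D (f a b) x)) \<otimes> (?u \<otimes> D c (D a (D b x)))
      = (D (f a b) (D c x) \<otimes> ?u) \<otimes> (D c (D (f a b) x) \<otimes> D c (D a (D b x)))"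
    using cl a b c x ab by (simp add: m_ac)
  also have "\<dots> = (D a (D c x) \<otimes> D c (D a x)) \<otimes> (D b (D c x) \<otimes> D c (D b x))"
    unfolding 1 2 using cl a b c x by (simp add: m_ac)
  finally have 3: "?u \<otimes> D c (D a (D b x)) = \<one>"
    using anti a b c x ab cl by simp
  have "D a (D b (D c x) \<otimes> D c (D b x)) = \<one>" using anti one a b c x by simp
  then have 4: "?u \<otimes> D a (D c (D b x)) = \<one>" using hom cl a b c x by simp
  have 5: "D c (D a (D b x)) \<otimes> D a (D c (D b x)) = \<one>" using anti a b c x cl by simp
  \<comment> \<open>Moving \<open>c\<close> past \<open>b\<close> and then past \<open>a\<close>
    changes the sign twice, so the two products agree, while fact 3 makes them mutually inverse.
    Hence the square of \<open>?u\<close> is trivial, and by \<open>cube\<close> so is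
    \<open>?u\<close>.\<close>
  have "?u = D c (D a (D b x))"
    using 4 5 cl a b c x by (metis right_cancel)
  then show ?thesis using 3 cube[OF u] u by simp
qed

section \<open>Conjugation and commutators\<close>

definition (in monoid) commutator :: "'a \<Rightarrow> 'a \<Rightarrow> 'a" where
  "commutator x g = x \<otimes> g \<otimes> inv x \<otimes> inv g"

definition (in monoid) conjugate :: "'a \<Rightarrow> 'a \<Rightarrow> 'a" where
  "conjugate g x = g \<otimes> x \<otimes> inv g"

context group
begin

lemma conjugate_closed [simp, intro]: "g \<in> carrier G \<Longrightarrow> x \<in> carrier G \<Longrightarrow> conjugate g x \<in> carrier G"
  by (simp add: conjugate_def)

lemma commutator_closed [simp, intro]:
  "g \<in> carrier G \<Longrightarrow> x \<in> carrier G \<Longrightarrow> commutator x g \<in> carrier G"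
  by (simp add: commutator_def)

lemma inv_cancel_left [simp]:
  "x \<in> carrier G \<Longrightarrow> y \<in> carrier G \<Longrightarrow> inv x \<otimes> (x \<otimes> y) = y"
  "x \<in> carrier G \<Longrightarrow> y \<in> carrier G \<Longrightarrow> x \<otimes> (inv x \<otimes> y) = y"
  by (simp_all flip: m_assoc)

text \<open>On an abelian normal subgroup this exhibits the commutator with \<open>g\<close> as the
  operator 1 - g, where g acts by conjugation.\<close>

lemma commutator_conjugate:
  "g \<in> carrier G \<Longrightarrow> x \<in> carrier G \<Longrightarrow> commutator x g = x \<otimes> inv (conjugate g x)"
  by (simp add: commutator_def conjugate_def m_assoc inv_mult_group)

lemma conjugate_mult:
  "\<lbrakk>g \<in> carrier G; x \<in> carrier G; y \<in> carrier G\<rbrakk> \<Longrightarrow> conjugate g (x \<otimes> y) = conjugate g x \<otimes> conjugate g y"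
  by (simp add: conjugate_def m_assoc)

lemma conjugate_conjugate:
  "\<lbrakk>g \<in> carrier G; h \<in> carrier G; x \<in> carrier G\<rbrakk> \<Longrightarrow> conjugate g (conjugate h x) = conjugate (g \<otimes> h) x"
  by (simp add: conjugate_def m_assoc inv_mult_group)

lemma conjugate_inv:
  "\<lbrakk>g \<in> carrier G; x \<in> carrier G\<rbrakk> \<Longrightarrow> conjugate g (inv x) = inv (conjugate g x)"
  by (simp add: conjugate_def m_assoc inv_mult_group)

lemma conjugate_by_one [simp]: "x \<in> carrier G \<Longrightarrow> conjugate \<one> x = x"
  by (simp add: conjugate_def)

lemma conjugate_one [simp]: "g \<in> carrier G \<Longrightarrow> conjugate g \<one> = \<one>"
  by (simp add: conjugate_def)

lemma conjugate_pow:
  "\<lbrakk>g \<in> carrier G; x \<in> carrier G\<rbrakk> \<Longrightarrow> conjugate g (x [^] (n::nat)) = conjugate g x [^] n"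
  by (induction n) (simp_all add: conjugate_mult)

lemma conjugate_commute_iff:
  assumes "g \<in> carrier G" "x \<in> carrier G" "y \<in> carrier G"
  shows "conjugate g x \<otimes> y = y \<otimes> conjugate g x \<longleftrightarrow> x \<otimes> conjugate (inv g) y = conjugate (inv g) y \<otimes> x"
proof -
  have "conjugate (inv g) (conjugate g x \<otimes> y) = x \<otimes> conjugate (inv g) y"
    "conjugate (inv g) (y \<otimes> conjugate g x) = conjugate (inv g) y \<otimes> x"
    using assms by (simp_all add: conjugate_mult conjugate_conjugate)
  moreover have "conjugate g (x \<otimes> conjugate (inv g) y) = conjugate g x \<otimes> y"
    "conjugate g (conjugate (inv g) y \<otimes> x) = y \<otimes> conjugate g x"
    using assms by (simp_all add: conjugate_mult conjugate_conjugate)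
  ultimately show ?thesis by metis
qed

lemma inv_commute:
  assumes "x \<in> carrier G" "z \<in> carrier G" "x \<otimes> z = z \<otimes> x"
  shows "inv x \<otimes> z = z \<otimes> inv x"
proof -
  have "inv x \<otimes> (x \<otimes> z) \<otimes> inv x = inv x \<otimes> (z \<otimes> x) \<otimes> inv x"
    using assms(3) by simp
  then show ?thesis using assms(1,2) by (simp add: m_assoc)
qed

lemma commute_mult:
  assumes "x \<in> carrier G" "y \<in> carrier G" "z \<in> carrier G" "x \<otimes> z = z \<otimes> x" "y \<otimes> z = z \<otimes> y"
  shows "x \<otimes> y \<otimes> z = z \<otimes> (x \<otimes> y)"
  using assms by (metis m_assoc)

section \<open>An abelian normal subgroup containing a given element\<close>

text \<open>The centralizer C of all conjugates of \<open>n\<close> is normal, and it contains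
  \<open>n\<close> because \<open>n\<close> commutes with its conjugates. The centre of C is
  therefore abelian, normal in \<open>G\<close> and contains \<open>n\<close>; the witness is its
  intersection with \<open>N\<close>.\<close>

lemma centre_of_centralizer_abelian_normal:
  assumes N: "N \<lhd> G" and n: "n \<in> N"
    and comm: "\<And>g. g \<in> carrier G \<Longrightarrow> n \<otimes> conjugate g n = conjugate g n \<otimes> n"
  obtains A where "subgroup A G" "n \<in> A" "A \<subseteq> N"
    "\<And>x y. x \<in> A \<Longrightarrow> y \<in> A \<Longrightarrow> x \<otimes> y = y \<otimes> x"
    "\<And>x g. x \<in> A \<Longrightarrow> g \<in> carrier G \<Longrightarrow> conjugate g x \<in> A"
proof -
  interpret N: normal N G by (rule N)
  have nG: "n \<in> carrier G" using n N.subset by blast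
  define C where "C = {z \<in> carrier G. \<forall>g \<in> carrier G. z \<otimes> conjugate g n = conjugate g n \<otimes> z}"
  define A where "A = {x \<in> N \<inter> C. \<forall>z \<in> C. x \<otimes> z = z \<otimes> x}"
  have CG: "C \<subseteq> carrier G" by (auto simp: C_def)
  have conjC: "conjugate g z \<in> C" if "g \<in> carrier G" "z \<in> C" for g z
    using that nG by (auto simp: C_def conjugate_commute_iff conjugate_conjugate)
  have conjN: "conjugate g x \<in> N" if "g \<in> carrier G" "x \<in> N" for g x
    using N.inv_op_closed2 that by (simp add: conjugate_def)
  have multC: "x \<otimes> y \<in> C" if "x \<in> C" "y \<in> C" for x y
    using that nG by (auto simp: C_def commute_mult)
  have invC: "inv x \<in> C" if "x \<in> C" for x
    using that nG by (auto simp: C_def inv_commute)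
  have oneC: "\<one> \<in> C" using nG by (auto simp: C_def)
  have "n \<in> A"
  proof -
    have "n \<in> C" using nG comm by (auto simp: C_def)
    \<comment> \<open>\<open>n\<close> is its own conjugate by \<open>\<one>\<close>, so each
      element of \<open>C\<close> commutes with it.\<close>
    moreover have "n \<otimes> z = z \<otimes> n" if "z \<in> C" for z
      using that nG unfolding C_def by (auto dest!: bspec[OF _ one_closed])
    ultimately show ?thesis using n by (auto simp: A_def)
  qed
  moreover have "subgroup A G"
  proof
    show "A \<subseteq> carrier G" using CG by (auto simp: A_def)
    show "\<one> \<in> A" using CG oneC by (auto simp: A_def)
    fix x assume x: "x \<in> A"
    then have x': "x \<in> N" "x \<in> C" "x \<in> carrier G" "\<And>z. z \<in> C \<Longrightarrow> x \<otimes> z = z \<otimes> x"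
      using CG unfolding A_def by blast+
    have "inv x \<otimes> z = z \<otimes> inv x" if "z \<in> C" for z
      using inv_commute[OF x'(3) _ x'(4)] that CG by blast
    then show "inv x \<in> A"
      using x'(1,2) invC unfolding A_def by blast
    fix y assume y: "y \<in> A"
    then have y': "y \<in> N" "y \<in> C" "y \<in> carrier G" "\<And>z. z \<in> C \<Longrightarrow> y \<otimes> z = z \<otimes> y"
      using CG unfolding A_def by blast+
    have "x \<otimes> y \<otimes> z = z \<otimes> (x \<otimes> y)" if "z \<in> C" for z
      using commute_mult[OF x'(3) y'(3) _ x'(4) y'(4)] that CG by blast
    then show "x \<otimes> y \<in> A"
      using x'(1,2) y'(1,2) multC unfolding A_def by blast
  qed
  moreover have "conjugate g x \<in> A" if "x \<in> A" "g \<in> carrier G" for x g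
  proof -
    have "conjugate g x \<otimes> z = z \<otimes> conjugate g x" if z: "z \<in> C" for z
    proof -
      have "conjugate (inv g) z \<in> C" using \<open>g \<in> carrier G\<close> z conjC by simp
      then show ?thesis using \<open>x \<in> A\<close> \<open>g \<in> carrier G\<close> z CG
        by (subst conjugate_commute_iff) (auto simp: A_def)
    qed
    then show ?thesis using that conjC conjN by (auto simp: A_def)
  qed
  moreover have "A \<subseteq> N" unfolding A_def by blast
  moreover have "x \<otimes> y = y \<otimes> x" if "x \<in> A" "y \<in> A" for x y
    using that unfolding A_def by blast
  ultimately show ?thesis using that[of A] by blast
qed

section \<open>Triple commutators in semi-3-abelian groups\<close>

lemma nat_pow_3: "x \<in> carrier G \<Longrightarrow> x [^] (3::nat) = x \<otimes> x \<otimes> x"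
  by (simp add: numeral_3_eq_3)

text \<open>Closure under products is where semi-abelianness enters: if both powers are
  \<open>\<one>\<close>, so is their product, hence also the power of the product.\<close>

lemma omega_normal:
  assumes "semi_pi_abelian p i G"
  shows "{x \<in> carrier G. x [^] (p ^ i) = \<one>} \<lhd> G" (is "?N \<lhd> G")
proof (rule normal_invI)
  show "subgroup ?N G"
    using assms by unfold_locales (auto simp: semi_pi_abelian_def nat_pow_inv)
  fix x h assume "x \<in> carrier G" "h \<in> ?N"
  then show "x \<otimes> h \<otimes> inv x \<in> ?N"
    using conjugate_pow[of x h "p ^ i"] conjugate_closed[of x h] by (simp add: conjugate_def)
qed

text \<open>The product of \<open>inv g\<close> and \<open>g \<otimes> n\<close> is
  \<open>n\<close>, whose cube is trivial. The hypothesis for this pair says that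
  \<open>g \<otimes> n\<close> and \<open>g\<close> have the same cube; expanding and cancelling
  gives the claim.\<close>

lemma semi_3_abelian_translate:
  assumes "semi_pi_abelian 3 1 G" "g \<in> carrier G" "n \<in> carrier G" "n [^] (3::nat) = \<one>"
  shows "n \<otimes> conjugate g n \<otimes> conjugate (g \<otimes> g) n = \<one>"
proof -
  have "(inv g \<otimes> (g \<otimes> n)) [^] (3::nat) = \<one>" using assms by simp
  then have "inv g [^] (3::nat) \<otimes> (g \<otimes> n) [^] (3::nat) = \<one>"
    using assms(1)[unfolded semi_pi_abelian_def, rule_format, of "inv g" "g \<otimes> n"] assms(2,3) by simp
  then have "inv (g [^] (3::nat)) \<otimes> (g \<otimes> n) [^] (3::nat) = \<one>"
    using assms by (simp add: nat_pow_inv)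
  then have "(g \<otimes> n) [^] (3::nat) = g [^] (3::nat)"
    using assms by (metis inv_closed inv_equality inv_inv m_closed nat_pow_closed inv_comm)
  then have "n \<otimes> (g \<otimes> (n \<otimes> (g \<otimes> n))) = g \<otimes> g"
    using assms by (simp add: nat_pow_3 m_assoc)
  moreover have "n \<otimes> conjugate g n \<otimes> conjugate (g \<otimes> g) n = n \<otimes> (g \<otimes> (n \<otimes> (g \<otimes> n))) \<otimes> inv (g \<otimes> g)"
    using assms by (simp add: conjugate_def m_assoc inv_mult_group)
  ultimately show ?thesis using assms by simp
qed

text \<open>The previous identity for \<open>inv g\<close>, conjugated by
  \<open>g \<otimes> g\<close>, is the identity for \<open>g\<close> with its factors in reverse
  order. So both products equal the inverse of \<open>conjugate (g \<otimes> g) n\<close>.\<close>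

lemma semi_3_abelian_conjugateugate_commute:
  assumes "semi_pi_abelian 3 1 G" "g \<in> carrier G" "n \<in> carrier G" "n [^] (3::nat) = \<one>"
  shows "n \<otimes> conjugate g n = conjugate g n \<otimes> n"
proof -
  have "conjugate (g \<otimes> g) (n \<otimes> conjugate (inv g) n \<otimes> conjugate (inv g \<otimes> inv g) n) = \<one>"
    using semi_3_abelian_translate[of "inv g" n] assms by simp
  then have "conjugate (g \<otimes> g) n \<otimes> conjugate g n \<otimes> n = \<one>"
    using assms by (simp add: conjugate_mult conjugate_conjugate m_assoc)
  then have "conjugate g n \<otimes> n = inv (conjugate (g \<otimes> g) n)"
    using assms by (metis conjugate_closed inv_equality inv_inv m_assoc m_closed inv_comm)
  moreover have "n \<otimes> conjugate g n = inv (conjugate (g \<otimes> g) n)"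
    using semi_3_abelian_translate[OF assms] assms by (metis conjugate_closed inv_equality m_closed)
  ultimately show ?thesis by simp
qed

lemma semi_3_abelian_triple_commutator:
  assumes semi: "semi_pi_abelian 3 1 G"
    and n: "n \<in> carrier G" "n [^] (3::nat) = \<one>"
    and a: "a \<in> carrier G" and b: "b \<in> carrier G" and c: "c \<in> carrier G"
  shows "commutator (commutator (commutator n a) b) c = \<one>"
proof -
  let ?N = "{x \<in> carrier G. x [^] (3 ^ 1 :: nat) = \<one>}"
  obtain A where A: "subgroup A G" "n \<in> A" "A \<subseteq> ?N"
    and comm: "\<And>x y. x \<in> A \<Longrightarrow> y \<in> A \<Longrightarrow> x \<otimes> y = y \<otimes> x"
    and conjA: "\<And>x g. x \<in> A \<Longrightarrow> g \<in> carrier G \<Longrightarrow> conjugate g x \<in> A"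
    by (rule centre_of_centralizer_abelian_normal[OF omega_normal[OF semi], of n])
      (use n semi_3_abelian_conjugateugate_commute[OF semi _ n] in auto)
  let ?H = "G\<lparr>carrier := A\<rparr>"
  interpret A: subgroup A G by (rule A)
  interpret H: comm_group ?H
    by (rule group.group_comm_groupI) (use A comm in \<open>auto intro: subgroup_imp_group\<close>)
  have invA: "inv\<^bsub>?H\<^esub> x = inv x" if "x \<in> A" for x
    using m_inv_consistent[OF A(1) that] .
  have cmA: "commutator x g = x \<otimes> inv (conjugate g x)" if "x \<in> A" "g \<in> carrier G" for x g
    using that commutator_conjugate by auto
  have cmAcl: "commutator x g \<in> A" if "x \<in> A" "g \<in> carrier G" for x g
    using that cmA conjA by auto
  have lcomm: "x \<otimes> (y \<otimes> z) = y \<otimes> (x \<otimes> z)" if "x \<in> A" "y \<in> A" "z \<in> A" for x y z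
    using H.m_lcomm that by simp
  have cube: "x \<otimes> x \<otimes> x = \<one>" if "x \<in> A" for x
    using that A(3) nat_pow_3[of x] by auto
  \<comment> \<open>In operator terms, (1 - g)^2 = (1 + g + g^2) - 3g. The first summand vanishes by
    \<open>semi_3_abelian_translate\<close>, the second because \<open>A\<close> has exponent
    3.\<close>
  have sq: "commutator (commutator x g) g = \<one>" if x: "x \<in> A" and g: "g \<in> carrier G" for x g
  proof -
    let ?y = "conjugate g x" and ?z = "conjugate (g \<otimes> g) x"
    have yz: "?y \<in> A" "?z \<in> A" using conjA x g by simp_all
    have z: "inv ?z = x \<otimes> ?y"
      using semi_3_abelian_translate[OF semi g, of x] x A(3) yz
      by (intro inv_equality) auto
    have 1: "conjugate g (inv ?y) = x \<otimes> ?y"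
      using x g by (simp add: conjugate_inv conjugate_conjugate flip: z)
    have "conjugate g (commutator x g) = ?y \<otimes> (x \<otimes> ?y)"
      using x g yz 1 by (simp add: cmA conjugate_mult)
    then have "commutator (commutator x g) g = x \<otimes> inv ?y \<otimes> inv (?y \<otimes> (x \<otimes> ?y))"
      using x g cmAcl by (simp add: cmA)
    also have "?y \<otimes> (x \<otimes> ?y) = x \<otimes> (?y \<otimes> ?y)" using x yz lcomm by simp
    also have "x \<otimes> inv ?y \<otimes> inv (x \<otimes> (?y \<otimes> ?y)) = inv ?y \<otimes> inv ?y \<otimes> inv ?y"
      using x yz by (simp add: inv_mult_group m_assoc comm lcomm)
    also have "\<dots> = \<one>" using cube yz by simp
    finally show ?thesis .
  qed
  have hom: "commutator (x \<otimes> y) g = commutator x g \<otimes> commutator y g"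
    if "x \<in> A" "y \<in> A" "g \<in> carrier G" for x y g
    using that conjA by (simp add: cmA conjugate_mult inv_mult_group m_assoc comm lcomm)
  \<comment> \<open>This is (1 - gh) + (1 - g)(1 - h) = (1 - g) + (1 - h).\<close>
  have comp: "commutator x (g \<otimes> h) \<otimes> commutator (commutator x h) g = commutator x g \<otimes> commutator x h"
    if x: "x \<in> A" and g: "g \<in> carrier G" and h: "h \<in> carrier G" for x g h
  proof -
    let ?u = "conjugate g x" and ?v = "conjugate h x" and ?w = "conjugate (g \<otimes> h) x"
    have mem: "?u \<in> A" "?v \<in> A" "?w \<in> A" using conjA x g h by simp_all
    have "commutator (commutator x h) g = x \<otimes> inv ?v \<otimes> inv (?u \<otimes> inv ?w)"
      using x g h mem cmAcl by (simp add: cmA conjugate_mult conjugate_inv conjugate_conjugate)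
    then show ?thesis using x g h mem
      by (simp add: cmA inv_mult_group m_assoc comm lcomm)
  qed
  \<comment> \<open>The innermost commutator is the operator applied first, hence the order
    \<open>c b a\<close>.\<close>
  show ?thesis
    using H.square_zero_operators_triple[of "carrier G" "(\<otimes>)" "\<lambda>g x. commutator x g" c b a n]
      cmAcl hom sq comp cube a b c A(2) by simp
qed

section \<open>Centres modulo a normal subgroup and the lower central series\<close>

text \<open>For normal \<open>K\<close>, this is the preimage of the centre of the quotient by
  \<open>K\<close>, phrased inside \<open>G\<close> so that it can be iterated.\<close>

definition centre_mod :: "'a set \<Rightarrow> 'a set" where
  "centre_mod K = {x \<in> carrier G. \<forall>g \<in> carrier G. commutator x g \<in> K}"

text \<open>Commutators of products, inverses and conjugates are built from conjugates of
  commutators that lie in \<open>K\<close>, and \<open>K\<close> is closed under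
  conjugation.\<close>

lemma centre_mod_normal:
  assumes "K \<lhd> G"
  shows "centre_mod K \<lhd> G"
proof -
  interpret K: normal K G by (rule assms)
  have conjK: "conjugate g x \<in> K" if "g \<in> carrier G" "x \<in> K" for g x
    using K.inv_op_closed2 that by (simp add: conjugate_def)
  show ?thesis
  proof (rule normal_invI)
    show "subgroup (centre_mod K) G"
    proof
      show "centre_mod K \<subseteq> carrier G" by (auto simp: centre_mod_def)
      show "\<one> \<in> centre_mod K" by (auto simp: centre_mod_def commutator_def)
      fix x y assume x: "x \<in> centre_mod K" and y: "y \<in> centre_mod K"
      have "commutator (x \<otimes> y) g = conjugate x (commutator y g) \<otimes> commutator x g"
        if "g \<in> carrier G" for g
        using that x y by (simp add: centre_mod_def commutator_def conjugate_def m_assoc inv_mult_group)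
      then show "x \<otimes> y \<in> centre_mod K"
        using x y conjK by (auto simp: centre_mod_def)
    next
      fix x assume x: "x \<in> centre_mod K"
      have "commutator (inv x) g = conjugate (inv x) (inv (commutator x g))"
        if "g \<in> carrier G" for g
        using that x by (simp add: centre_mod_def commutator_def conjugate_def m_assoc inv_mult_group)
      then show "inv x \<in> centre_mod K"
        using x conjK by (auto simp: centre_mod_def)
    qed
  next
    fix h x assume h: "h \<in> carrier G" and x: "x \<in> centre_mod K"
    have "commutator (conjugate h x) g = conjugate h (commutator x (conjugate (inv h) g))"
      if "g \<in> carrier G" for g
      using that h x by (simp add: centre_mod_def commutator_def conjugate_def m_assoc inv_mult_group)
    then have "conjugate h x \<in> centre_mod K"
      using h x conjK by (auto simp: centre_mod_def)
    then show "h \<otimes> x \<otimes> inv h \<in> centre_mod K" by (simp add: conjugate_def)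
  qed
qed

lemma lower_central_Suc_subset:
  assumes "subgroup K G" "lower_central G c \<subseteq> centre_mod K"
  shows "lower_central G (Suc c) \<subseteq> K"
proof -
  have "{h \<otimes> k \<otimes> inv h \<otimes> inv k |h k. h \<in> lower_central G c \<and> k \<in> carrier G} \<subseteq> K"
    using assms(2) by (auto simp: centre_mod_def commutator_def)
  then show ?thesis
    using generate_subgroup_incl[OF _ assms(1)] by (simp add: comm_subgroup_def)
qed

lemma one_in_lower_central: "\<one> \<in> lower_central G c"
  by (cases c) (auto simp: comm_subgroup_def intro: generate.one)

lemma nilpotency_class_le:
  assumes "lower_central G c \<subseteq> {\<one>}"
  shows "nilpotency_class G \<le> c"
  unfolding nilpotency_class_def
  using assms one_in_lower_central by (intro Least_le) blast

end

section \<open>Passing to the quotient by the elements killed by \<open>p ^ i\<close>\<close>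

lemma hom_commutator:
  assumes "group G" "group H" "\<phi> \<in> hom G H" "x \<in> carrier G" "g \<in> carrier G"
  shows "\<phi> (monoid.commutator G x g) = monoid.commutator H (\<phi> x) (\<phi> g)"
proof -
  interpret group_hom G H \<phi> using assms by (simp add: group_hom_def group_hom_axioms_def)
  show ?thesis using assms(4,5) by (simp add: G.commutator_def H.commutator_def)
qed

text \<open>A coset is trivial iff the \<open>p ^ i\<close>-th power of its representative is. Level
  \<open>Suc i\<close> for \<open>a\<close>, \<open>b\<close> and level \<open>i\<close> for their
  \<open>p\<close>-th powers lead to the same equation, which links the two sides.\<close>

lemma (in group) omega_quotient_semi_p_abelian:
  assumes i: "semi_pi_abelian p i G" and Suc: "semi_pi_abelian p (Suc i) G"
  shows "semi_pi_abelian p 1 (G Mod {x \<in> carrier G. x [^] (p ^ i) = \<one>})" (is "semi_pi_abelian p 1 (G Mod ?N)")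
proof -
  define N where "N = ?N"
  interpret N: normal N G unfolding N_def by (rule omega_normal[OF i])
  interpret Q: group "G Mod N" by (rule N.factorgroup_is_group)
  interpret h: group_hom G "G Mod N" "(#>) N"
    by unfold_locales (rule N.r_coset_hom_Mod)
  have triv: "N #> x = \<one>\<^bsub>G Mod N\<^esub> \<longleftrightarrow> x [^] (p ^ i) = \<one>" if "x \<in> carrier G" for x
  proof -
    have "N #> x = N \<longleftrightarrow> x \<in> N"
      using that coset_join1[of N x] coset_join2[of x N] N.subgroup_axioms N.subset by blast
    moreover have "x \<in> N \<longleftrightarrow> x [^] (p ^ i) = \<one>" using that unfolding N_def by blast
    ultimately show ?thesis by (simp add: FactGroup_def)
  qed
  show ?thesis
    unfolding N_def[symmetric] semi_pi_abelian_def
  proof (intro ballI)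
    fix U V assume "U \<in> carrier (G Mod N)" "V \<in> carrier (G Mod N)"
    then obtain a b where ab: "a \<in> carrier G" "b \<in> carrier G" "U = N #> a" "V = N #> b"
      by (auto simp: FactGroup_def RCOSETS_def)
    have "(U \<otimes>\<^bsub>G Mod N\<^esub> V) [^]\<^bsub>G Mod N\<^esub> (p ^ 1) = N #> ((a \<otimes> b) [^] p)"
      unfolding ab(3,4) h.hom_mult[OF ab(1,2), symmetric]
      using ab(1,2) h.hom_nat_pow[of "a \<otimes> b" p] by simp
    moreover have "U [^]\<^bsub>G Mod N\<^esub> (p ^ 1) \<otimes>\<^bsub>G Mod N\<^esub> V [^]\<^bsub>G Mod N\<^esub> (p ^ 1)
        = N #> (a [^] p \<otimes> b [^] p)"
      using h.hom_mult[of "a [^] p" "b [^] p"] ab by (simp add: h.hom_nat_pow)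
    moreover have "((a \<otimes> b) [^] p) [^] (p ^ i) = \<one> \<longleftrightarrow> (a [^] p \<otimes> b [^] p) [^] (p ^ i) = \<one>"
      using i Suc ab by (simp add: semi_pi_abelian_def nat_pow_pow)
    ultimately show "((U \<otimes>\<^bsub>G Mod N\<^esub> V) [^]\<^bsub>G Mod N\<^esub> (p ^ 1) = \<one>\<^bsub>G Mod N\<^esub>) \<longleftrightarrow>
        (U [^]\<^bsub>G Mod N\<^esub> (p ^ 1) \<otimes>\<^bsub>G Mod N\<^esub> V [^]\<^bsub>G Mod N\<^esub> (p ^ 1) = \<one>\<^bsub>G Mod N\<^esub>)"
      using triv[of "(a \<otimes> b) [^] p"] triv[of "a [^] p \<otimes> b [^] p"] ab(1,2)
      by (simp only: m_closed nat_pow_closed)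
  qed
qed

text \<open>The image of \<open>x\<close> in the quotient by the elements killed by
  \<open>3 ^ i\<close> has trivial cube, so the triple commutator result applies there.\<close>

lemma (in group) omega_triple_commutator:
  assumes i: "semi_pi_abelian 3 i G" and Suc: "semi_pi_abelian 3 (Suc i) G"
    and x: "x \<in> carrier G" "x [^] ((3::nat) ^ Suc i) = \<one>"
    and abc: "a \<in> carrier G" "b \<in> carrier G" "c \<in> carrier G"
  shows "commutator (commutator (commutator x a) b) c \<in> {x \<in> carrier G. x [^] ((3::nat) ^ i) = \<one>}"
    (is "?u \<in> ?N")
proof -
  define N where "N = ?N"
  interpret N: normal N G unfolding N_def by (rule omega_normal[OF i])
  interpret Q: group "G Mod N" by (rule N.factorgroup_is_group)
  interpret h: group_hom G "G Mod N" "(#>) N"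
    by unfold_locales (rule N.r_coset_hom_Mod)
  have "(x [^] (3::nat)) [^] ((3::nat) ^ i) = \<one>" using x by (simp add: nat_pow_pow)
  then have "x [^] (3::nat) \<in> N" using x unfolding N_def by blast
  then have "(N #> x) [^]\<^bsub>G Mod N\<^esub> (3::nat) = \<one>\<^bsub>G Mod N\<^esub>"
    using x coset_join2[of "x [^] (3::nat)" N] N.subgroup_axioms
    by (simp flip: h.hom_nat_pow)
  then have "Q.commutator (Q.commutator (Q.commutator (N #> x) (N #> a)) (N #> b)) (N #> c)
      = \<one>\<^bsub>G Mod N\<^esub>"
    using x abc by (intro Q.semi_3_abelian_triple_commutator omega_quotient_semi_p_abelian[of 3 i, folded N_def] i Suc) auto
  then have "N #> ?u = N"
    using x abc h.homh is_group Q.is_group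
    by (simp add: hom_commutator[OF is_group Q.is_group h.homh, symmetric])
  then show ?thesis unfolding N_def[symmetric] using x abc coset_join1[of N ?u] N.subgroup_axioms N.subset by blast
qed

section \<open>Descent along the lower central series and the class bound\<close>

lemma (in group) lower_central_subset_omega:
  assumes semi: "strongly_semi_p_abelian 3 G"
    and exp: "\<And>x. x \<in> carrier G \<Longrightarrow> x [^] ((3::nat) ^ r) = \<one>"
  shows "j \<le> r \<Longrightarrow> lower_central G (3 * j) \<subseteq> {x \<in> carrier G. x [^] ((3::nat) ^ (r - j)) = \<one>}"
proof (induction j)
  case 0
  then show ?case using exp by auto
next
  case (Suc j)
  let ?i = "r - Suc j"
  let ?N = "{x \<in> carrier G. x [^] ((3::nat) ^ ?i) = \<one>}"
  \<comment> \<open>Level 0 arises when \<open>Suc j = r\<close> and lies outside the hypothesis;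
    there both sides of the equivalence say that the product is \<open>\<one>\<close>.\<close>
  have semi': "semi_pi_abelian 3 k G" for k
  proof (cases k)
    case 0
    then show ?thesis by (simp add: semi_pi_abelian_def)
  next
    case (Suc k)
    then show ?thesis using semi by (simp add: strongly_semi_p_abelian_def)
  qed
  have "r - j = Suc ?i" using Suc.prems by simp
  then have "lower_central G (3 * j) \<subseteq> {x \<in> carrier G. x [^] ((3::nat) ^ Suc ?i) = \<one>}"
    using Suc by (metis Suc_leD)
  \<comment> \<open>Each of the three layers is peeled off by one step of the lower central
    series.\<close>
  also have "\<dots> \<subseteq> centre_mod (centre_mod (centre_mod ?N))"
    using omega_triple_commutator[OF semi' semi', of _ ?i] unfolding centre_mod_def by auto
  finally have "lower_central G (Suc (Suc (Suc (3 * j)))) \<subseteq> ?N"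
    by (intro lower_central_Suc_subset normal_imp_subgroup centre_mod_normal omega_normal semi')
  then show ?case by (simp add: numeral_3_eq_3)
qed

lemma (in group) generated_by_one_abelian:
  assumes "generated_by_at_most 1 G"
  shows "lower_central G 1 \<subseteq> {\<one>}"
proof -
  obtain S where S: "S \<subseteq> carrier G" "finite S" "card S \<le> 1" "generate G S = carrier G"
    using assms by (auto simp: generated_by_at_most_def)
  obtain s where s: "s \<in> carrier G" "S \<subseteq> {s}"
  proof (cases "S = {}")
    case True
    then show ?thesis using that[of \<one>] by simp
  next
    case False
    then have "card S = 1" using S by (simp add: card_gt_0_iff le_eq_less_or_eq)
    then obtain s where "S = {s}" by (auto simp: card_1_singleton_iff)
    then show ?thesis using that S by auto
  qed
  have gen: "generate G {s} = carrier G"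
    using mono_generate[OF s(2)] S(4) generate_incl[of "{s}"] s(1) by auto
  have "x \<otimes> y = y \<otimes> x" if xy: "x \<in> carrier G" "y \<in> carrier G" for x y
  proof -
    obtain k l :: int where "x = s [^] k" "y = s [^] l"
      using xy generate_pow[OF s(1)] gen by auto
    then show ?thesis using s(1) by (simp add: add.commute flip: int_pow_mult)
  qed
  then have "lower_central G 0 \<subseteq> centre_mod {\<one>}"
    by (auto simp: centre_mod_def commutator_def m_assoc)
  then show ?thesis using lower_central_Suc_subset[OF triv_subgroup, of 0] by simp
qed

text \<open>The exponent is bounded only in size, but element orders are powers of \<open>p\<close>,
  and for these size comparison implies divisibility.\<close>

lemma p_group_exponent:
  assumes G: "p_group p G" and p: "Factorial_Ring.prime p" and e: "group_exponent G \<le> p ^ r" and x: "x \<in> carrier G"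
  shows "x [^]\<^bsub>G\<^esub> (p ^ r) = \<one>\<^bsub>G\<^esub>"
proof -
  interpret group G using G by (simp add: p_group_def)
  obtain n where fin: "finite (carrier G)" and n: "order G = p ^ n" using G by (auto simp: p_group_def)
  obtain k where k: "ord x = p ^ k"
    using ord_dvd_group_order[OF x] n p divides_primepow_nat by auto
  have "ord x dvd group_exponent G" using x by (auto simp: group_exponent_def)
  \<comment> \<open>Passing from divisibility to size requires a nonzero multiple, since every
    number divides 0.\<close>
  moreover have "group_exponent G \<noteq> 0"
  proof -
    have "0 \<notin> ord ` carrier G" using ord_ge_1[OF fin] by force
    then show ?thesis using fin by (simp add: group_exponent_def Lcm_0_iff)
  qed
  ultimately have "p ^ k \<le> p ^ r" using e k by (metis dvd_imp_le le_trans not_gr_zero)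
  then have "k \<le> r" using prime_gt_1_nat[OF p] by simp
  then have "ord x dvd p ^ r" using k by (simp add: le_imp_power_dvd)
  then show ?thesis using pow_eq_id[OF x] by simp
qed

theorem theorem1p1:
  fixes G :: "('a, 'b) monoid_scheme" and r d :: nat
  assumes "p_group 3 G"
    and "strongly_semi_p_abelian 3 G"
    and "r \<ge> 1"
    and "group_exponent G \<le> 3 ^ r"
    and "generated_by_at_most d G"
  shows "int (nilpotency_class G) \<le> (int r - 1) * (int d + 1) + 3"
proof -
  interpret group G using assms(1) by (simp add: p_group_def)
  show ?thesis
  \<comment> \<open>For \<open>d\<close> at least 2 the claimed bound is at least 3(r - 1) + 3 = 3r.
    For smaller \<open>d\<close> it can fall below 3r, but then \<open>G\<close> is cyclic and its
    class is at most 1.\<close>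
  proof (cases "d \<le> 1")
    case True
    then have "generated_by_at_most 1 G"
      using assms(5) unfolding generated_by_at_most_def by (meson le_trans)
    then have "nilpotency_class G \<le> 1" by (intro nilpotency_class_le generated_by_one_abelian)
    moreover have "0 \<le> (int r - 1) * (int d + 1)" using assms(3) by simp
    ultimately show ?thesis by linarith
  next
    case False
    \<comment> \<open>At \<open>j = r\<close> the exponent is \<open>3 ^ 0\<close>, so only
      \<open>\<one>\<close> is killed.\<close>
    have "lower_central G (3 * r) \<subseteq> {\<one>\<^bsub>G\<^esub>}"
      using lower_central_subset_omega[OF assms(2), of r r] p_group_exponent[OF assms(1) _ assms(4)]
      by auto
    then have "nilpotency_class G \<le> 3 * r" by (rule nilpotency_class_le)
    then have "int (nilpotency_class G) \<le> 3 * int r" by linarith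
    moreover have "(int r - 1) * 3 \<le> (int r - 1) * (int d + 1)"
      using assms(3) False by (intro mult_left_mono) auto
    ultimately show ?thesis by (simp add: algebra_simps)
  qed
qed

end
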